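(* Let $\mathcal{C}_1\subseteq\mathbb{F}_{q^m}^n$ be a linear code and $\mathcal{C}_2\subsetneqq\mathcal{C}_1$ a subcode with $\dim\mathcal{C}_2=\dim\mathcal{C}_1-l$. Let $S\in\mathbb{F}_{q^m}^l$ be a random variable with an arbitrary distribution, let $\psi:\mathbb{F}_{q^m}^l\to\mathcal{C}_1/\mathcal{C}_2$ be a bijective function, and, given $S$, let $X\in\mathbb{F}_{q^m}^n$ be a random variable arbitrarily distributed over the coset $\psi(S)$. Fix an arbitrary matrix $B\in\mathbb{F}_{q^m}^{\mu\times n}$ over $\mathbb{F}_{q^m}$ and let $W^{\rm T}=BX^{\rm T}$. Then: 1) For any distributions of $S$ and $X$, $$I(S;W)\le\dim(\mathcal{C}_2^\perp\cap\mathrm{row}(B))-\dim(\mathcal{C}_1^\perp\cap\mathrm{row}(B))+D(X\|U_{\psi(S)}|S)$$ and $$I(S;W)\ge\dim(\mathcal{C}_2^\perp\cap\mathrm{row}(B))-\dim(\mathcal{C}_1^\perp\cap\mathrm{row}(B))-D(S\|U_{\mathbb{F}_{q^m}^l}).$$ 2) If $S$ and $X$ are uniformly distributed over $\mathbb{F}_{q^m}^l$ and $\mathcal{C}_1$ respectively, both inequalities are equalities, i.e. $I(S;W)=\dim(\mathcal{C}_2^\perp\cap\mathrm{row}(B))-\dim(\mathcal{C}_1^\perp\cap\mathrm{row}(B))$. 3) If $I(S;W)=0$ holds for a distribution of $S$ that assigns a positive probability to every element of $\mathbb{F}_{q^m}^l$, then $\dim(\mathcal{C}_2^\perp\cap\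mathrm{row}(B))-\dim(\mathcal{C}_1^\perp\cap\mathrm{row}(B))=0$.
   Context: $\mathbb{F}_{q^m}$ is the degree-$m$ extension ($m\ge1$) of the finite field $\mathbb{F}_q$. Linear codes are $\mathbb{F}_{q^m}$-subspaces of the row space $\mathbb{F}_{q^m}^n$; dimensions are over $\mathbb{F}_{q^m}$; $\mathcal{C}^\perp$ is the dual code for the standard bilinear form. $\mathrm{row}(B)=\{uB:u\in\mathbb{F}_{q^m}^\mu\}$ is the row space of $B$ over $\mathbb{F}_{q^m}$. Mutual information $I$ and relative entropy $D$ use logarithms to base $q^m$. $D(S\|U_{\mathbb{F}_{q^m}^l})$ is the relative entropy between the distribution of $S$ and the uniform distribution on $\mathbb{F}_{q^m}^l$; $D(X\|U_{\psi(S)}|S)=\sum_s P_S(s)\,D(P_{X|S=s}\,\|\,\text{uniform distribution on }\psi(s))$. *)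

theory Defs
  imports "HOL-Probability.Probability" "HOL-Number_Theory.Prime_Powers"
begin

definition dual_code :: "('k::field ^ 'n) set \<Rightarrow> ('k ^ 'n) set" where
  "dual_code C = {v. \<forall>c\<in>C. scalar_product v c = 0}"

definition row_space :: "'k::field ^ 'n ^ 'r \<Rightarrow> ('k ^ 'n) set" where
  "row_space B = range (\<lambda>u. u v* B)"

definition cosets :: "'a::ab_group_add set \<Rightarrow> 'a set \<Rightarrow> 'a set set" where
  "cosets C D = (\<lambda>x. (+) x ` D) ` C"

text \<open>All random variables below take values in finite types, which carry the discrete
  sigma algebra.\<close>

abbreviation uniform_dist :: "'a set \<Rightarrow> 'a measure" where
  "uniform_dist A \<equiv> measure_pmf (pmf_of_set A)"

abbreviation dist_of :: "'w measure \<Rightarrow> ('w \<Rightarrow> 'a) \<Rightarrow> 'a measure" where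
  "dist_of M X \<equiv> distr M (count_space UNIV) X"

definition cond_dist :: "'w measure \<Rightarrow> ('w \<Rightarrow> 'a) \<Rightarrow> ('w \<Rightarrow> 'b) \<Rightarrow> 'b \<Rightarrow> 'a measure" where
  "cond_dist M X S s = dist_of (uniform_measure M (S -` {s} \<inter> space M)) X"

text \<open>In \<^const>\<open>KL_divergence\<close> the reference measure comes first: the relative entropy
  of \<open>P\<close> with respect to \<open>Q\<close> is \<open>KL_divergence b Q P\<close>.\<close>

definition rel_entropy :: "real \<Rightarrow> 'a measure \<Rightarrow> 'a measure \<Rightarrow> real" where
  "rel_entropy b P Q = KL_divergence b Q P"

text \<open>Values \<open>s\<close> of probability zero contribute nothing to the following sum, whatever
  \<^const>\<open>cond_dist\<close> is there.\<close>

definition cond_rel_entropy_uniform ::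
  "real \<Rightarrow> 'w measure \<Rightarrow> ('w \<Rightarrow> 'a) \<Rightarrow> ('w \<Rightarrow> 'b::finite) \<Rightarrow> ('b \<Rightarrow> 'a set) \<Rightarrow> real" where
  "cond_rel_entropy_uniform b M X S \<psi> =
    (\<Sum>s\<in>UNIV. measure (dist_of M S) {s} *
      rel_entropy b (cond_dist M X S s) (uniform_dist (\<psi> s)))"

abbreviation mutual_info :: "real \<Rightarrow> 'w measure \<Rightarrow> ('w \<Rightarrow> 'a) \<Rightarrow> ('w \<Rightarrow> 'b) \<Rightarrow> real" where
  "mutual_info b M X Y \<equiv>
    prob_space.mutual_information M b (count_space UNIV) (count_space UNIV) X Y"

end

theory Submission
  imports Defs
begin

text \<open>
  Let \<open>V = B C\<^sub>1\<close> and \<open>U = B C\<^sub>2\<close>. Since \<open>scalar_product (u v* B) c = scalar_product u (B *v c)\<close>,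
  the space \<open>dual_code C \<inter> row_space B\<close> is the image under \<open>u \<mapsto> u v* B\<close> of the dual of \<open>B C\<close>, which
  contains the kernel of that map; hence \<open>b powr \<Delta> = |V| / |U|\<close>.

  The gap in the upper bound is the relative entropy of the law of \<open>X\<close> with respect to the
  sub-probability \<open>x \<mapsto> P(s, w) / P(w) * |U| / (|V| |C\<^sub>2|)\<close>, where \<open>s\<close> and \<open>w\<close> are the values
  belonging to \<open>x\<close>; the gap in the lower bound is that of the law of \<open>(S, W)\<close> with respect to
  \<open>P(w) |V| / (|U| CARD('k ^ 'l))\<close> on the pairs \<open>(s, w)\<close> with \<open>w \<in> B \<psi>(s)\<close>. Both are nonnegative by
  the Gibbs inequality, and the normalisations only count fibres of \<open>x \<mapsto> B *v x\<close>. In the uniform case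
  the two bounds coincide. If \<open>S\<close> and \<open>W\<close> are independent and \<open>S\<close> has full support, a possible value
  of \<open>W\<close> lies in every \<open>B \<psi>(s)\<close>, which forces \<open>V = U\<close>.
\<close>

section \<open>Fibres and images of additive maps on finite groups\<close>

lemma card_fibre_additive:
  fixes f :: "'a::ab_group_add \<Rightarrow> 'b::ab_group_add"
  assumes diff: "\<And>x y. f (x - y) = f x - f y"
    and A: "\<And>x y. x \<in> A \<Longrightarrow> y \<in> A \<Longrightarrow> x + y \<in> A" "\<And>x y. x \<in> A \<Longrightarrow> y \<in> A \<Longrightarrow> x - y \<in> A"
    and y: "y \<in> A"
  shows "card {x \<in> A. f x = f y} = card {x \<in> A. f x = 0}"
proof (rule bij_betw_same_card[of "\<lambda>x. x - y"])
  have add: "f (z + y) = f z + f y" for z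
    using diff[of "z + y" y] by (simp add: algebra_simps)
  show "bij_betw (\<lambda>x. x - y) {x \<in> A. f x = f y} {x \<in> A. f x = 0}"
    by (rule bij_betw_byWitness[where f' = "\<lambda>x. x + y"]) (auto simp: diff add A y)
qed

lemma card_eq_image_kernel:
  fixes f :: "'a::ab_group_add \<Rightarrow> 'b::ab_group_add"
  assumes diff: "\<And>x y. f (x - y) = f x - f y"
    and A: "\<And>x y. x \<in> A \<Longrightarrow> y \<in> A \<Longrightarrow> x + y \<in> A" "\<And>x y. x \<in> A \<Longrightarrow> y \<in> A \<Longrightarrow> x - y \<in> A"
    and fin: "finite A"
  shows "card A = card (f ` A) * card {x \<in> A. f x = 0}"
proof -
  have "card A = (\<Sum>w\<in>f ` A. card {x \<in> A. f x = w})"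
    using sum.image_gen[OF fin, of "\<lambda>_. 1::nat" f] by simp
  also have "\<dots> = (\<Sum>w\<in>f ` A. card {x \<in> A. f x = 0})"
    using card_fibre_additive[OF diff A] by (intro sum.cong) auto
  finally show ?thesis by simp
qed

section \<open>Cardinalities of subspaces and dual codes\<close>

lemma vec_subspace_image_matrix:
  fixes B :: "'k::field ^ 'n ^ 'r"
  assumes "vec.subspace C"
  shows "vec.subspace ((*v) B ` C)"
  using assms matrix_vector_mul_linear_gen vec.linear_subspace_image by blast

text \<open>Induction over a basis: adjoining an independent vector \<open>a\<close> to
  \<open>E\<close> multiplies the size of the span by \<open>CARD('k)\<close>, because
  \<open>t *s a + v\<close> with \<open>v\<close> in the old span represents each vector of the new
  span exactly once.\<close>

lemma card_vec_subspace:
  fixes C :: "('k::{field,finite} ^ 'n::finite) set"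
  assumes "vec.subspace C"
  shows "card C = CARD('k) ^ vec.dim C"
proof -
  have span: "vec.independent E \<Longrightarrow> card (vec.span E) = CARD('k) ^ card E"
    if "finite E" for E :: "('k ^ 'n) set"
    using that
  proof (induction E)
    case empty
    then show ?case by simp
  next
    case (insert a E)
    then have a: "a \<notin> vec.span E" and E: "vec.independent E"
      using vec.independent_insert[of a E] by (auto split: if_splits)
    have "bij_betw (\<lambda>(t, v). t *s a + v) (UNIV \<times> vec.span E) (vec.span (insert a E))"
    proof (rule bij_betw_imageI)
      show "inj_on (\<lambda>(t, v). t *s a + v) (UNIV \<times> vec.span E)"
      proof (rule inj_onI, clarify)
        fix t v t' v'
        assume v: "v \<in> vec.span E" "v' \<in> vec.span E" and eq: "t *s a + v = t' *s a + v'"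
        have "(t - t') *s a = v' - v"
          using eq by (simp add: vec.scale_left_diff_distrib algebra_simps)
        \<comment> \<open>For distinct \<open>t\<close> and \<open>t'\<close> the left side is
          \<open>a\<close> itself, which would put \<open>a\<close> into the span of
          \<open>E\<close>.\<close>
        then have "inverse (t - t') *s ((t - t') *s a) \<in> vec.span E"
          using vec.span_scale[OF vec.span_diff[OF v(2,1)]] by simp
        then have "t = t'"
          unfolding vec.scale_scale using a by (cases "t = t'") simp_all
        with eq show "t = t' \<and> v = v'" by simp
      qed
      show "(\<lambda>(t, v). t *s a + v) ` (UNIV \<times> vec.span E) = vec.span (insert a E)"
      proof (intro equalityI subsetI)
        fix x assume "x \<in> vec.span (insert a E)"
        then obtain t where "x - t *s a \<in> vec.span E" by (auto simp: vec.span_insert)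
        then show "x \<in> (\<lambda>(t, v). t *s a + v) ` (UNIV \<times> vec.span E)"
          by (intro image_eqI[of _ _ "(t, x - t *s a)"]) auto
      qed (auto simp: vec.span_insert, metis add_diff_cancel_left')
    qed
    then have "card (vec.span (insert a E)) = CARD('k) * card (vec.span E)"
      by (metis bij_betw_same_card card_cartesian_product)
    then show ?case using insert E by simp
  qed
  obtain E where "vec.independent E" "C \<subseteq> vec.span E" "card E = vec.dim C" "E \<subseteq> C"
    using vec.basis_exists by metis
  moreover from this have "vec.span E = C"
    using assms vec.span_minimal by blast
  ultimately show ?thesis using span[of E] by simp
qed

text \<open>Multiples of \<open>d\<close> already attain every field element under
  \<open>\<phi>\<close>, so the kernel has index \<open>CARD('k)\<close> in \<open>D\<close>. The
  double count below applies this in each argument of \<open>scalar_product\<close>.\<close>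

lemma card_functional_kernel:
  fixes \<phi> :: "'k::{field,finite} ^ 'n::finite \<Rightarrow> 'k"
  assumes D: "vec.subspace D"
    and diff: "\<And>x y. \<phi> (x - y) = \<phi> x - \<phi> y" and scale: "\<And>c x. \<phi> (c *s x) = c * \<phi> x"
    and d: "d \<in> D" "\<phi> d \<noteq> 0"
  shows "card D = CARD('k) * card {x \<in> D. \<phi> x = 0}"
proof -
  have "t \<in> \<phi> ` D" for t
    using d vec.subspace_scale[OF D d(1), of "t / \<phi> d"] scale[of "t / \<phi> d" d] by force
  then have "\<phi> ` D = UNIV" by auto
  then show ?thesis
    using card_eq_image_kernel[OF diff, of D] vec.subspace_add[OF D] vec.subspace_diff[OF D] by simp
qed

lemma scalar_product_linear:
  fixes u v w :: "'k::field ^ 'n"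
  shows "scalar_product u (v - w) = scalar_product u v - scalar_product u w"
    and "scalar_product (u - v) w = scalar_product u w - scalar_product v w"
    and "scalar_product u (c *s v) = c * scalar_product u v"
    and "scalar_product (c *s u) v = c * scalar_product u v"
    and "scalar_product u 0 = 0" and "scalar_product 0 u = 0"
  by (simp_all add: scalar_product_def algebra_simps sum_subtractf sum_distrib_left)

lemma vec_subspace_dual_code: "vec.subspace (dual_code D)"
proof -
  have "scalar_product (x + y) c = scalar_product x c + scalar_product y c"
    for x y c :: "'a::field ^ 'b"
    by (simp add: scalar_product_def algebra_simps sum.distrib)
  then show ?thesis
    by (auto simp: vec.subspace_def dual_code_def scalar_product_linear)
qed

text \<open>Double counting of the orthogonal pairs \<open>(u, d)\<close> with \<open>d \<in> D\<close>.\<close>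
lemma card_dual_code:
  fixes D :: "('k::{field,finite} ^ 'n::finite) set"
  assumes D: "vec.subspace D"
  shows "card D * card (dual_code D) = CARD('k) ^ CARD('n)"
proof -
  define Q where "Q = real CARD('k)"
  define N where "N = real CARD('k ^ 'n)"
  have Q: "Q > 1"
  proof -
    have "card {0, 1 :: 'k} \<le> CARD('k)" by (intro card_mono) auto
    then show ?thesis by (simp add: Q_def)
  qed
  \<comment> \<open>Multiplying by \<open>Q\<close> turns both cases into \<open>card D\<close> plus
    a correction carried only by dual vectors; \<open>d\<close> below is the mirror image, with a
    correction only at \<open>d = 0\<close>.\<close>
  have u: "Q * card {d \<in> D. scalar_product u d = 0} =
      card D + (if u \<in> dual_code D then (Q - 1) * card D else 0)" for u
  proof (cases "u \<in> dual_code D")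
    case True
    then have "{d \<in> D. scalar_product u d = 0} = D" by (auto simp: dual_code_def)
    then show ?thesis using True by (simp add: algebra_simps)
  next
    case False
    then obtain d where "d \<in> D" "scalar_product u d \<noteq> 0" by (auto simp: dual_code_def)
    then have "card D = CARD('k) * card {d \<in> D. scalar_product u d = 0}"
      by (intro card_functional_kernel[OF D]) (simp_all add: scalar_product_linear)
    then show ?thesis using False by (simp add: Q_def)
  qed
  have d: "Q * card {u. scalar_product u d = 0} = N + (if d = 0 then (Q - 1) * N else 0)" for d :: "'k ^ 'n"
  proof (cases "d = 0")
    case True
    then show ?thesis by (simp add: algebra_simps scalar_product_linear N_def)
  next
    case False
    then obtain i where i: "d $ i \<noteq> 0" by (auto simp: vec_eq_iff)
    \<comment> \<open>A unit vector at a nonzero coordinate of \<open>d\<close> witnesses that the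
      functional is not zero.\<close>
    have "scalar_product (axis i 1) d = d $ i"
      by (simp add: scalar_product_def axis_def if_distrib if_distribR cong: if_cong)
    with i card_functional_kernel[of UNIV "\<lambda>u. scalar_product u d" "axis i 1"]
    show ?thesis using False by (simp add: scalar_product_linear Q_def N_def)
  qed
  have "(\<Sum>u\<in>UNIV. card {d \<in> D. scalar_product u d = 0}) = (\<Sum>d\<in>D. card {u. scalar_product u d = 0})"
    using sum_multicount_gen[of UNIV D "\<lambda>u d. scalar_product u d = 0" "\<lambda>d. card {u. scalar_product u d = 0}"]
    by simp
  then have "(\<Sum>u\<in>UNIV. Q * card {d \<in> D. scalar_product u d = 0}) =
      (\<Sum>d\<in>D. Q * card {u. scalar_product u d = 0})"
    unfolding sum_distrib_left[symmetric] of_nat_sum[symmetric] by simp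
  \<comment> \<open>The main terms on the two sides agree and cancel; the corrections share the
    factor \<open>Q - 1\<close>, which is nonzero.\<close>
  then have "N * card D + (Q - 1) * (card D * card (dual_code D)) = card D * N + (Q - 1) * N"
    unfolding u d sum.distrib using vec.subspace_0[OF D]
    by (simp add: N_def sum.If_cases mult.assoc mult.left_commute mult.commute)
  then have "(Q - 1) * real (card D * card (dual_code D)) = (Q - 1) * N"
    by (simp add: mult.commute)
  then have "real (card D * card (dual_code D)) = N"
    using Q by (simp only: mult_cancel_left) simp
  then show ?thesis
    unfolding N_def of_nat_eq_iff by simp
qed

lemma scalar_product_vector_matrix:
  "scalar_product (u v* B) c = scalar_product u (B *v c)"
  for B :: "'k::field ^ 'n ^ 'r"
  by (auto simp: scalar_product_def vector_matrix_mult_def matrix_vector_mult_def sum_distrib_left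
      sum_distrib_right mult_ac intro: sum.swap)

text \<open>By adjointness \<open>u v* B\<close> is dual to \<open>C\<close> exactly when
  \<open>u\<close> is dual to the image of \<open>C\<close> under \<open>B\<close>. The last factor
  on the left and the right side do not depend on \<open>C\<close>, so they cancel when two codes
  are compared.\<close>

lemma card_dual_code_row_space:
  fixes B :: "'k::{field,finite} ^ 'n::finite ^ 'r::finite"
  assumes C: "vec.subspace C"
  shows "card (dual_code C \<inter> row_space B) * card ((*v) B ` C) * card {u. u v* B = 0} =
    CARD('k) ^ CARD('r)"
proof -
  let ?D = "dual_code ((*v) B ` C)"
  have "dual_code C \<inter> row_space B = (\<lambda>u. u v* B) ` ?D"
    by (auto simp: dual_code_def row_space_def scalar_product_vector_matrix)
  moreover have "{u \<in> ?D. u v* B = 0} = {u. u v* B = 0}"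
    by (auto simp: dual_code_def scalar_product_vector_matrix[symmetric] scalar_product_linear)
  ultimately have "card ?D = card (dual_code C \<inter> row_space B) * card {u. u v* B = 0}"
    using card_eq_image_kernel[of "\<lambda>u. u v* B" ?D, OF vector_matrix_mult_diff_distrib
        vec.subspace_add[OF vec_subspace_dual_code] vec.subspace_diff[OF vec_subspace_dual_code]]
    by simp
  with card_dual_code[OF vec_subspace_image_matrix[OF C], of B]
  show ?thesis by (simp add: mult_ac)
qed

lemma card_dual_code_row_space_ratio:
  fixes B :: "'k::{field,finite} ^ 'n::finite ^ 'r::finite"
  assumes C: "vec.subspace C" and D: "vec.subspace D"
  shows "real CARD('k) powr (real (vec.dim (dual_code D \<inter> row_space B))
      - real (vec.dim (dual_code C \<inter> row_space B))) = card ((*v) B ` C) / card ((*v) B ` D)"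
proof -
  \<comment> \<open>The row space is the image of the whole space under the transposed
    matrix.\<close>
  have row: "vec.subspace (row_space B)"
    unfolding row_space_def transpose_matrix_vector[symmetric]
    by (intro vec_subspace_image_matrix vec.subspace_UNIV)
  have card: "card (dual_code E \<inter> row_space B) = CARD('k) ^ vec.dim (dual_code E \<inter> row_space B)" for E
    by (intro card_vec_subspace vec.subspace_inter row vec_subspace_dual_code)
  have k: "card {u. u v* B = 0} > 0"
    by (subst card_gt_0_iff) (auto intro!: exI[of _ 0])
  have im: "card ((*v) B ` C) > 0" "card ((*v) B ` D) > 0"
    using vec.subspace_0[OF C] vec.subspace_0[OF D] by (auto simp: card_gt_0_iff simp del: card_0_eq)
  have "card (dual_code C \<inter> row_space B) * card ((*v) B ` C) =
      card (dual_code D \<inter> row_space B) * card ((*v) B ` D)"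
    using card_dual_code_row_space[OF C, of B] card_dual_code_row_space[OF D, of B] k
    by (metis mult_cancel2 less_numeral_extra(3))
  then have "real CARD('k) ^ vec.dim (dual_code C \<inter> row_space B) * card ((*v) B ` C) =
      real CARD('k) ^ vec.dim (dual_code D \<inter> row_space B) * card ((*v) B ` D)"
    unfolding card by (metis of_nat_mult of_nat_power)
  then show ?thesis
    using im vec.subspace_0[OF D] by (auto simp: powr_diff powr_realpow field_simps)
qed

section \<open>Gibbs inequality and information bounds on a partitioned finite set\<close>

lemma Gibbs_inequality:
  fixes p q :: "'a \<Rightarrow> real"
  assumes "finite A" and b: "1 < b"
    and p: "\<And>x. x \<in> A \<Longrightarrow> 0 \<le> p x"
    and q: "\<And>x. x \<in> A \<Longrightarrow> p x \<noteq> 0 \<Longrightarrow> 0 < q x"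
  shows "(\<Sum>x\<in>A. p x) - (\<Sum>x\<in>{x\<in>A. p x \<noteq> 0}. q x) \<le> ln b * (\<Sum>x\<in>A. p x * log b (p x / q x))"
proof -
  \<comment> \<open>This is \<open>ln t \<le> t - 1\<close> at \<open>t = q x / p x\<close>.
    Counting \<open>q\<close> only on the support of \<open>p\<close> admits an unnormalised
    \<open>q\<close>, and later bounds the mass of \<open>q\<close> off the support.\<close>
  have "p x - (if p x \<noteq> 0 then q x else 0) \<le> ln b * (p x * log b (p x / q x))" if x: "x \<in> A" for x
  proof (cases "p x = 0")
    case False
    then have pos: "p x > 0" "q x > 0" using p[OF x] q[OF x] by auto
    then have "ln (q x / p x) \<le> q x / p x - 1" by (intro ln_le_minus_one) simp
    moreover have "ln (p x / q x) = - ln (q x / p x)" using pos by (simp add: ln_div)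
    ultimately have "p x * (1 - q x / p x) \<le> p x * ln (p x / q x)"
      using pos by (intro mult_left_mono) auto
    then show ?thesis using pos b by (simp add: log_def algebra_simps)
  qed simp
  then have "(\<Sum>x\<in>A. p x - (if p x \<noteq> 0 then q x else 0)) \<le> (\<Sum>x\<in>A. ln b * (p x * log b (p x / q x)))"
    by (rule sum_mono)
  then show ?thesis
    using \<open>finite A\<close> by (simp add: sum_subtractf sum_distrib_left sum.inter_filter)
qed

text \<open>The combinatorial core of coset coding: the blocks \<open>\<psi> s\<close> stand for the
  cosets and \<open>\<beta>\<close> for multiplication by \<open>B\<close>. A fibre of
  \<open>\<beta>\<close> has \<open>K\<close> points in each block that it meets and
  \<open>L\<close> points in the union; these become the sizes of the kernel of \<open>B\<close> on
  the small and on the large code.\<close>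

locale partitioned_distribution =
  fixes p :: "'x::finite \<Rightarrow> real" and \<psi> :: "'s::finite \<Rightarrow> 'x set" and \<beta> :: "'x \<Rightarrow> 'w::finite"
    and b :: real and N K L :: nat
  assumes b: "1 < b"
    and p_nonneg: "\<And>x. 0 \<le> p x"
    and sum_p: "(\<Sum>s\<in>UNIV. \<Sum>x\<in>\<psi> s. p x) = 1"
    and disj: "\<And>s t. s \<noteq> t \<Longrightarrow> \<psi> s \<inter> \<psi> t = {}"
    and card_block: "\<And>s. card (\<psi> s) = N"
    and card_fibre_block: "\<And>s x. x \<in> \<psi> s \<Longrightarrow> card {y \<in> \<psi> s. \<beta> y = \<beta> x} = K"
    and card_fibre: "\<And>x. x \<in> (\<Union>s. \<psi> s) \<Longrightarrow> card {y \<in> (\<Union>s. \<psi> s). \<beta> y = \<beta> x} = L"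
begin

definition pS where "pS s = (\<Sum>x\<in>\<psi> s. p x)"
definition pSW where "pSW s w = (\<Sum>x\<in>{x \<in> \<psi> s. \<beta> x = w}. p x)"
definition pW where "pW w = (\<Sum>s\<in>UNIV. pSW s w)"
text \<open>The factor \<open>pSW s w\<close> supplies the convention 0 log 0 = 0, so the sums may
  run over all values.\<close>

definition information where
  "information = (\<Sum>s\<in>UNIV. \<Sum>w\<in>UNIV. pSW s w * log b (pSW s w / (pS s * pW w)))"

text \<open>The quotient of the number of values of \<open>\<beta>\<close> on the union of the blocks by the number
  of its values on a single block.\<close>
definition ratio where "ratio = real CARD('s) * K / L"

lemma nonneg: "0 \<le> pS s" "0 \<le> pSW s w" "0 \<le> pW w"
  by (auto simp: pS_def pSW_def pW_def p_nonneg intro!: sum_nonneg)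

lemma sum_pS: "(\<Sum>s\<in>UNIV. pS s) = 1"
  using sum_p by (simp add: pS_def)

lemma sum_block: "(\<Sum>x\<in>\<psi> s. p x * h (\<beta> x)) = (\<Sum>w\<in>UNIV. pSW s w * h w)"
  unfolding pSW_def sum_distrib_right
  by (subst sum.group[of "\<psi> s" UNIV \<beta> "\<lambda>x. p x * h (\<beta> x)", symmetric]) auto

lemma sum_pSW: "(\<Sum>w\<in>UNIV. pSW s w) = pS s"
  using sum_block[where s = s and h = "\<lambda>_. 1"] by (simp add: pS_def)

lemma sum_pW: "(\<Sum>w\<in>UNIV. pW w) = 1"
  unfolding pW_def by (subst sum.swap) (simp add: sum_pSW sum_pS)

lemma pSW_le: "pSW s w \<le> pS s" "pSW s w \<le> pW w"
proof -
  show "pSW s w \<le> pS s" unfolding sum_pSW[symmetric]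
    by (rule member_le_sum) (auto simp: nonneg)
  show "pSW s w \<le> pW w" unfolding pW_def
    by (rule member_le_sum) (auto simp: nonneg)
qed

lemma p_le: "x \<in> \<psi> s \<Longrightarrow> p x \<le> pSW s (\<beta> x)"
  unfolding pSW_def by (rule member_le_sum) (auto simp: p_nonneg)

lemma pos: "x \<in> \<psi> s \<Longrightarrow> 0 < p x \<Longrightarrow> 0 < pS s \<and> 0 < pSW s (\<beta> x) \<and> 0 < pW (\<beta> x)"
  using p_le[of x s] pSW_le[of s "\<beta> x"] by linarith

lemma pSW_nonzeroE:
  assumes "pSW s w \<noteq> 0"
  obtains x where "x \<in> \<psi> s" "\<beta> x = w"
  using assms unfolding pSW_def by (metis (mono_tags, lifting) mem_Collect_eq sum.neutral)

lemma pW_nonzeroE: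
  assumes "pW w \<noteq> 0"
  obtains s x where "x \<in> \<psi> s" "\<beta> x = w"
  using assms unfolding pW_def by (metis sum.neutral pSW_nonzeroE)

lemma pos_constants: "0 < N" "0 < K" "0 < L" "0 < ratio"
proof -
  obtain s x where x: "x \<in> \<psi> s"
    using sum_p by (metis sum.neutral zero_neq_one)
  show "0 < N" using card_block[of s] x by (metis card_gt_0_iff empty_iff finite)
  show "0 < K" using card_fibre_block[OF x] x by (auto simp: card_gt_0_iff)
  moreover have "x \<in> {y \<in> (\<Union>s. \<psi> s). \<beta> y = \<beta> x}" using x by auto
  then show "0 < L" using card_fibre[of x] x by (metis (no_types, lifting) UN_I UNIV_I card_gt_0_iff empty_iff finite)
  ultimately show "0 < ratio" by (simp add: ratio_def)
qed

text \<open>The disjoint blocks cut the \<open>L\<close> points of the fibre through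
  \<open>x\<close> into pieces that are empty or have \<open>K\<close> points.\<close>

lemma card_blocks_meeting_fibre:
  assumes "x \<in> \<psi> t"
  shows "card {s. \<beta> x \<in> \<beta> ` \<psi> s} * K = L"
proof -
  have "L = card (\<Union>s. {y \<in> \<psi> s. \<beta> y = \<beta> x})"
    using card_fibre[of x] assms by (auto intro!: arg_cong[of _ _ card])
  also have "\<dots> = (\<Sum>s\<in>UNIV. card {y \<in> \<psi> s. \<beta> y = \<beta> x})"
    by (rule card_UN_disjoint) (use disj in auto)
  also have "\<dots> = (\<Sum>s\<in>{s. \<beta> x \<in> \<beta> ` \<psi> s}. card {y \<in> \<psi> s. \<beta> y = \<beta> x})"
    by (rule sum.mono_neutral_right) (auto simp: image_iff, metis)
  also have "\<dots> = (\<Sum>s\<in>{s. \<beta> x \<in> \<beta> ` \<psi> s}. K)"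
    by (rule sum.cong) (auto dest!: card_fibre_block)
  finally show ?thesis by simp
qed

text \<open>Both sides count the points of the union, once by fibres and once by blocks.\<close>

lemma card_values: "card (\<beta> ` (\<Union>s. \<psi> s)) * L = CARD('s) * N"
proof -
  have "CARD('s) * N = card (\<Union>s. \<psi> s)"
    by (subst card_UN_disjoint) (use disj in \<open>auto simp: card_block\<close>)
  also have "\<dots> = (\<Sum>w\<in>\<beta> ` (\<Union>s. \<psi> s). card {x \<in> (\<Union>s. \<psi> s). \<beta> x = w})"
    using sum.image_gen[of "\<Union>s. \<psi> s" "\<lambda>_. 1::nat" \<beta>] by simp
  also have "\<dots> = (\<Sum>w\<in>\<beta> ` (\<Union>s. \<psi> s). L)"
    using card_fibre by (intro sum.cong) auto
  finally show ?thesis by simp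
qed

lemma information_eq:
  "information = (\<Sum>s\<in>UNIV. \<Sum>x\<in>\<psi> s. p x * log b (pSW s (\<beta> x) / (pS s * pW (\<beta> x))))"
  unfolding information_def
  by (intro sum.cong refl, subst sum_block[where h = "\<lambda>w. log b (pSW _ w / (pS _ * pW w))"]) simp

lemma information_le:
  "information \<le> log b ratio + (\<Sum>s\<in>UNIV. \<Sum>x\<in>\<psi> s. p x * log b (p x / pS s * N))"
proof -
  \<comment> \<open>By \<open>card_values\<close>, \<open>ratio * N\<close> is \<open>K\<close>
    times the number of values of \<open>\<beta>\<close> on the union. So \<open>q\<close> draws
    \<open>w\<close> uniformly from these values, then \<open>s\<close> from its posterior given
    \<open>w\<close>, then \<open>x\<close> uniformly from the \<open>K\<close> points of block
    \<open>s\<close> over \<open>w\<close>. Values with \<open>pW w = 0\<close> get mass 0 by the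
    division convention.\<close>
  define q where "q = (\<lambda>(s, x). pSW s (\<beta> x) / (pW (\<beta> x) * (ratio * N)))"
  have term_eq: "p x * log b ratio + p x * log b (p x / pS s * N)
      - p x * log b (pSW s (\<beta> x) / (pS s * pW (\<beta> x))) = p x * log b (p x / q (s, x))"
    if x: "x \<in> \<psi> s" for s x
  proof (cases "p x = 0")
    case False
    then have "0 < p x" using p_nonneg[of x] by simp
    with pos[OF x] pos_constants b show ?thesis
      by (simp add: q_def log_mult log_divide algebra_simps)
  qed simp
  have "log b ratio = (\<Sum>s\<in>UNIV. \<Sum>x\<in>\<psi> s. p x * log b ratio)"
    using sum_p by (simp add: sum_distrib_right[symmetric])
  then have "log b ratio + (\<Sum>s\<in>UNIV. \<Sum>x\<in>\<psi> s. p x * log b (p x / pS s * N)) - information =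
     (\<Sum>s\<in>UNIV. \<Sum>x\<in>\<psi> s. p x * log b ratio + p x * log b (p x / pS s * N)
      - p x * log b (pSW s (\<beta> x) / (pS s * pW (\<beta> x))))"
    unfolding information_eq by (simp only: sum.distrib sum_subtractf)
  also have "\<dots> = (\<Sum>s\<in>UNIV. \<Sum>x\<in>\<psi> s. p x * log b (p x / q (s, x)))"
    by (intro sum.cong refl term_eq)
  also have "\<dots> = (\<Sum>z\<in>Sigma UNIV \<psi>. p (snd z) * log b (p (snd z) / q z))"
    by (simp add: sum.Sigma split_def)
  finally have gap: "log b ratio + (\<Sum>s\<in>UNIV. \<Sum>x\<in>\<psi> s. p x * log b (p x / pS s * N)) - information = \<dots>" .
  have "(\<Sum>z\<in>{z \<in> Sigma UNIV \<psi>. p (snd z) \<noteq> 0}. q z) \<le> (\<Sum>z\<in>Sigma UNIV \<psi>. q z)"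
    by (rule sum_mono2) (auto simp: q_def nonneg pos_constants less_imp_le)
  also have "\<dots> = (\<Sum>s\<in>UNIV. \<Sum>x\<in>\<psi> s. q (s, x))"
    by (simp add: sum.Sigma)
  also have "\<dots> = (\<Sum>s\<in>UNIV. \<Sum>w\<in>\<beta> ` (\<Union>s. \<psi> s). K * pSW s w / (pW w * (ratio * N)))"
  proof (rule sum.cong[OF refl])
    fix s
    have "(\<Sum>x\<in>\<psi> s. q (s, x)) =
        (\<Sum>w\<in>\<beta> ` (\<Union>s. \<psi> s). \<Sum>x\<in>{x \<in> \<psi> s. \<beta> x = w}. pSW s w / (pW w * (ratio * N)))"
      by (subst sum.group[of "\<psi> s" "\<beta> ` (\<Union>s. \<psi> s)" \<beta>, symmetric]) (auto simp: q_def)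
    also have "\<dots> = (\<Sum>w\<in>\<beta> ` (\<Union>s. \<psi> s). K * pSW s w / (pW w * (ratio * N)))"
    proof (intro sum.cong refl)
      \<comment> \<open>If \<open>pSW s w\<close> is nonzero, the block meets the fibre over
        \<open>w\<close> in exactly \<open>K\<close> points; otherwise both sides vanish.\<close>
      fix w
      show "(\<Sum>x\<in>{x \<in> \<psi> s. \<beta> x = w}. pSW s w / (pW w * (ratio * N))) =
          K * pSW s w / (pW w * (ratio * N))"
        using card_fibre_block by (cases "pSW s w = 0") (auto elim!: pSW_nonzeroE)
    qed
    finally show "(\<Sum>x\<in>\<psi> s. q (s, x)) = \<dots>" .
  qed
  also have "\<dots> = (\<Sum>w\<in>\<beta> ` (\<Union>s. \<psi> s). K * pW w / (pW w * (ratio * N)))"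
    by (subst sum.swap) (simp add: pW_def sum_distrib_left sum_divide_distrib)
  \<comment> \<open>Equality can fail here, because a value with \<open>pW w = 0\<close> contributes
    nothing on the left.\<close>
  also have "\<dots> \<le> (\<Sum>w\<in>\<beta> ` (\<Union>s. \<psi> s). K / (ratio * N))"
    by (rule sum_mono) (use pos_constants in auto)
  also have "\<dots> = real (card (\<beta> ` (\<Union>s. \<psi> s)) * L) / real (CARD('s) * N)"
    using pos_constants by (simp add: ratio_def)
  also have "\<dots> = 1"
    unfolding card_values using pos_constants by simp
  finally have "(\<Sum>z\<in>{z \<in> Sigma UNIV \<psi>. p (snd z) \<noteq> 0}. q z) \<le> 1" .
  moreover have "(\<Sum>z\<in>Sigma UNIV \<psi>. p (snd z)) = 1"
    using sum_p by (simp add: sum.Sigma split_def)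
  moreover have "(\<Sum>z\<in>Sigma UNIV \<psi>. p (snd z)) - (\<Sum>z\<in>{z \<in> Sigma UNIV \<psi>. p (snd z) \<noteq> 0}. q z)
      \<le> ln b * (\<Sum>z\<in>Sigma UNIV \<psi>. p (snd z) * log b (p (snd z) / q z))"
  proof (rule Gibbs_inequality)
    fix z assume "z \<in> Sigma UNIV \<psi>" "p (snd z) \<noteq> 0"
    then show "0 < q z"
      using pos[of "snd z" "fst z"] p_nonneg[of "snd z"] pos_constants
      by (auto simp: q_def split_def)
  qed (auto simp: b p_nonneg)
  ultimately have "0 \<le> ln b * (\<Sum>z\<in>Sigma UNIV \<psi>. p (snd z) * log b (p (snd z) / q z))"
    by linarith
  then show ?thesis
    using gap b by (simp add: zero_le_mult_iff)
qed

text \<open>Listing the support by \<open>w\<close> first turns the inner sum of a weight depending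
  only on \<open>w\<close> into a count of blocks.\<close>

lemma sum_support_eq:
  "(\<Sum>z\<in>{z. pSW (fst z) (snd z) \<noteq> 0}. g z) = (\<Sum>w\<in>UNIV. \<Sum>s\<in>{s. pSW s w \<noteq> 0}. g (s, w))"
  by (subst sum.Sigma) (auto intro!: sum.reindex_bij_witness[of _ prod.swap prod.swap])

lemma information_ge:
  "log b ratio - (\<Sum>s\<in>UNIV. pS s * log b (pS s * CARD('s))) \<le> information"
proof -
  \<comment> \<open>The factor \<open>ratio / CARD('s)\<close> equals \<open>K / L\<close>: given
    \<open>w\<close>, the weight is spread evenly over the \<open>L / K\<close> blocks that meet its
    fibre.\<close>
  define q where "q = (\<lambda>(s::'s, w). pW w * (ratio / CARD('s)))"
  have term_eq: "pSW s w * log b (pSW s w / (pS s * pW w)) - pSW s w * log b ratio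
      + pSW s w * log b (pS s * CARD('s)) = pSW s w * log b (pSW s w / q (s, w))" for s w
  proof (cases "pSW s w = 0")
    case False
    then have "0 < pSW s w" "0 < pS s" "0 < pW w"
      using nonneg(2)[of s w] pSW_le[of s w] by linarith+
    with pos_constants b show ?thesis
      by (simp add: q_def log_mult log_divide algebra_simps)
  qed simp
  have "log b ratio = (\<Sum>s\<in>UNIV. \<Sum>w\<in>UNIV. pSW s w * log b ratio)"
    by (simp add: sum_distrib_right[symmetric] sum_pSW sum_pS)
  moreover have "(\<Sum>s\<in>UNIV. pS s * log b (pS s * CARD('s))) =
      (\<Sum>s\<in>UNIV. \<Sum>w\<in>UNIV. pSW s w * log b (pS s * CARD('s)))"
    by (simp add: sum_distrib_right[symmetric] sum_pSW)
  ultimately have "information - log b ratio + (\<Sum>s\<in>UNIV. pS s * log b (pS s * CARD('s))) =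
     (\<Sum>s\<in>UNIV. \<Sum>w\<in>UNIV. pSW s w * log b (pSW s w / (pS s * pW w)) - pSW s w * log b ratio
      + pSW s w * log b (pS s * CARD('s)))"
    unfolding information_def by (simp only: sum.distrib sum_subtractf)
  also have "\<dots> = (\<Sum>s\<in>UNIV. \<Sum>w\<in>UNIV. pSW s w * log b (pSW s w / q (s, w)))"
    by (simp only: term_eq)
  also have "\<dots> = (\<Sum>z\<in>UNIV. pSW (fst z) (snd z) * log b (pSW (fst z) (snd z) / q z))"
    by (simp add: sum.cartesian_product split_def)
  finally have gap: "information - log b ratio + (\<Sum>s\<in>UNIV. pS s * log b (pS s * CARD('s))) = \<dots>" .
  have "(\<Sum>z\<in>{z. pSW (fst z) (snd z) \<noteq> 0}. q z) =
      (\<Sum>w\<in>UNIV. card {s. pSW s w \<noteq> 0} * (pW w * (ratio / CARD('s))))"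
    unfolding sum_support_eq by (simp add: q_def)
  also have "\<dots> \<le> (\<Sum>w\<in>UNIV. pW w)"
  proof (rule sum_mono)
    fix w
    show "card {s. pSW s w \<noteq> 0} * (pW w * (ratio / CARD('s))) \<le> pW w"
    proof (cases "pW w = 0")
      case False
      then obtain t x where x: "x \<in> \<psi> t" "\<beta> x = w" by (rule pW_nonzeroE)
      \<comment> \<open>Positive joint mass forces block \<open>s\<close> to meet the fibre over
        \<open>w\<close>, so at most \<open>L / K\<close> blocks are counted.\<close>
      have "card {s. pSW s w \<noteq> 0} \<le> card {s. \<beta> x \<in> \<beta> ` \<psi> s}"
        by (intro card_mono) (auto elim!: pSW_nonzeroE simp: x(2))
      then have "card {s. pSW s w \<noteq> 0} * K \<le> L"
        using card_blocks_meeting_fibre[OF x(1)] by (metis mult_le_mono1)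
      then have "real (card {s. pSW s w \<noteq> 0}) * K \<le> L"
        by (metis of_nat_le_iff of_nat_mult)
      then have "pW w * (real (card {s. pSW s w \<noteq> 0}) * K / L) \<le> pW w * 1"
        using pos_constants by (intro mult_left_mono nonneg) simp
      then show ?thesis by (simp add: ratio_def mult_ac)
    qed simp
  qed
  finally have "(\<Sum>z\<in>{z. pSW (fst z) (snd z) \<noteq> 0}. q z) \<le> 1"
    by (simp add: sum_pW)
  moreover have "(\<Sum>z\<in>UNIV. pSW (fst z) (snd z)) = 1"
    using sum_pS by (simp add: sum_pSW[symmetric] sum.cartesian_product split_def)
  moreover have "(\<Sum>z\<in>UNIV. pSW (fst z) (snd z)) - (\<Sum>z\<in>{z \<in> UNIV. pSW (fst z) (snd z) \<noteq> 0}. q z)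
      \<le> ln b * (\<Sum>z\<in>UNIV. pSW (fst z) (snd z) * log b (pSW (fst z) (snd z) / q z))"
  proof (rule Gibbs_inequality)
    fix z :: "'s \<times> 'w" assume "pSW (fst z) (snd z) \<noteq> 0"
    then have "0 < pW (snd z)"
      using nonneg(2)[of "fst z" "snd z"] pSW_le(2)[of "fst z" "snd z"] by linarith
    then show "0 < q z"
      using pos_constants by (simp add: q_def split_def)
  qed (auto simp: b nonneg)
  ultimately have "0 \<le> ln b * (\<Sum>z\<in>UNIV. pSW (fst z) (snd z) * log b (pSW (fst z) (snd z) / q z))"
    by simp
  then show ?thesis
    using gap b by (simp add: zero_le_mult_iff)
qed

text \<open>Zero information forces \<open>pSW s w = pS s * pW w\<close>; hence a value \<open>w\<close> of positive
  probability is taken on every block.\<close>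
lemma ratio_eq_1:
  assumes I: "information = 0" and full: "\<And>s. 0 < pS s"
  shows "ratio = 1"
proof -
  define q where "q = (\<lambda>z. pS (fst z) * pW (snd z))"
  have "(\<Sum>z\<in>UNIV. pSW (fst z) (snd z)) - (\<Sum>z\<in>{z \<in> UNIV. pSW (fst z) (snd z) \<noteq> 0}. q z)
      \<le> ln b * (\<Sum>z\<in>UNIV. pSW (fst z) (snd z) * log b (pSW (fst z) (snd z) / q z))"
  proof (rule Gibbs_inequality)
    fix z :: "'s \<times> 'w" assume "pSW (fst z) (snd z) \<noteq> 0"
    then have "0 < pW (snd z)"
      using nonneg(2)[of "fst z" "snd z"] pSW_le(2)[of "fst z" "snd z"] by linarith
    then show "0 < q z"
      using full by (simp add: q_def)
  qed (auto simp: b nonneg)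
  moreover have "(\<Sum>z\<in>UNIV. pSW (fst z) (snd z) * log b (pSW (fst z) (snd z) / q z)) = 0"
    using I by (simp add: information_def q_def sum.cartesian_product split_def)
  moreover have "(\<Sum>z\<in>UNIV. pSW (fst z) (snd z)) = 1"
    using sum_pS by (simp add: sum_pSW[symmetric] sum.cartesian_product split_def)
  moreover have "(\<Sum>z\<in>UNIV. q z) = 1"
  proof -
    have "(\<Sum>z\<in>UNIV. q z) = (\<Sum>s\<in>UNIV. \<Sum>w\<in>UNIV. pS s * pW w)"
      by (simp add: q_def sum.cartesian_product split_def)
    then show ?thesis by (simp add: sum_distrib_left[symmetric] sum_pW sum_pS)
  qed
  moreover have "(\<Sum>z\<in>UNIV. q z) = (\<Sum>z\<in>{z \<in> UNIV. pSW (fst z) (snd z) \<noteq> 0}. q z)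
      + (\<Sum>z\<in>{z. pSW (fst z) (snd z) = 0}. q z)"
    by (subst sum.union_disjoint[symmetric]) (auto intro!: sum.cong)
  \<comment> \<open>With zero information, Gibbs gives the product law \<open>q\<close> mass at
    least 1 on the support of the joint law. Its total mass is 1, so none is left elsewhere.\<close>
  ultimately have "(\<Sum>z\<in>{z. pSW (fst z) (snd z) = 0}. q z) \<le> 0"
    by simp
  then have null: "pSW s w = 0 \<Longrightarrow> q (s, w) \<le> 0" for s w
    using member_le_sum[of "(s, w)" "{z. pSW (fst z) (snd z) = 0}" q]
    by (force simp: q_def nonneg)
  obtain w where w: "pW w \<noteq> 0"
    using sum_pW by (metis sum.neutral zero_neq_one)
  then have "0 < pW w" using nonneg(3)[of w] by simp
  then have meet: "pSW s w \<noteq> 0" for s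
    using null[of s w] full[of s] by (auto simp: q_def mult_le_0_iff)
  obtain t x where x: "x \<in> \<psi> t" "\<beta> x = w" using w by (rule pW_nonzeroE)
  have "\<beta> x \<in> \<beta> ` \<psi> s" for s
    using meet[of s] x(2) by (metis pSW_nonzeroE imageI)
  \<comment> \<open>All blocks meet the fibre over \<open>w\<close>, so the block count is
    \<open>CARD('s)\<close>.\<close>
  then have "CARD('s) * K = L"
    using card_blocks_meeting_fibre[OF x(1)] by simp
  then have "real CARD('s) * K = L"
    by (metis of_nat_mult)
  then show ?thesis
    using pos_constants by (simp add: ratio_def)
qed

end

section \<open>Relative entropy and mutual information on finite types\<close>

lemma KL_divergence_finite:
  fixes P Q :: "'a::finite measure"
  assumes b: "1 < b" and fin: "finite_measure P" "finite_measure Q"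
    and sets: "sets P = UNIV" "sets Q = UNIV"
    and ac: "\<And>x. measure Q {x} = 0 \<Longrightarrow> measure P {x} = 0"
  shows "KL_divergence b Q P = (\<Sum>x\<in>UNIV. measure P {x} * log b (measure P {x} / measure Q {x}))"
proof -
  interpret sigma_finite_measure "count_space (UNIV :: 'a set)"
    by (rule sigma_finite_measure_count_space_finite) simp
  \<comment> \<open>On a finite type a finite measure has its point masses as density with respect
    to counting measure, which reduces the claim to the divergence of two densities.\<close>
  have dens: "R = density (count_space UNIV) (\<lambda>x. ennreal (measure R {x}))"
    if "finite_measure R" "sets R = UNIV" for R :: "'a measure"
  proof (rule measure_eqI_finite)
    interpret R: finite_measure R by fact
    show "emeasure R {x} = emeasure (density (count_space UNIV) (\<lambda>x. ennreal (measure R {x}))) {x}" for x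
      unfolding point_measure_def[symmetric]
      by (simp add: emeasure_point_measure_finite R.emeasure_eq_measure)
  qed (use that in auto)
  have "KL_divergence b Q P = KL_divergence b (density (count_space UNIV) (\<lambda>x. ennreal (measure Q {x})))
      (density (count_space UNIV) (\<lambda>x. ennreal (measure P {x})))"
    using dens[OF fin(1) sets(1)] dens[OF fin(2) sets(2)] by simp
  also have "\<dots> = (\<integral>x. measure P {x} * log b (measure P {x} / measure Q {x}) \<partial>count_space UNIV)"
    using b ac by (intro KL_density_density) auto
  finally show ?thesis
    by (simp add: lebesgue_integral_count_space_finite)
qed

lemma (in prob_space) mutual_information_finite:
  fixes X :: "'a \<Rightarrow> 'c::finite" and Y :: "'a \<Rightarrow> 'd::finite"
  assumes b: "1 < b"
    and [measurable]: "X \<in> measurable M (count_space UNIV)" "Y \<in> measurable M (count_space UNIV)"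
  shows "mutual_information b (count_space UNIV) (count_space UNIV) X Y =
    (\<Sum>x\<in>UNIV. \<Sum>y\<in>UNIV. prob {\<omega> \<in> space M. X \<omega> = x \<and> Y \<omega> = y} *
      log b (prob {\<omega> \<in> space M. X \<omega> = x \<and> Y \<omega> = y} /
        (prob {\<omega> \<in> space M. X \<omega> = x} * prob {\<omega> \<in> space M. Y \<omega> = y})))"
proof -
  let ?PX = "distr M (count_space UNIV) X" and ?PY = "distr M (count_space UNIV) Y"
  let ?PXY = "distr M (count_space UNIV \<Otimes>\<^sub>M count_space UNIV) (\<lambda>\<omega>. (X \<omega>, Y \<omega>))"
  interpret X: prob_space ?PX by (rule prob_space_distr) simp
  interpret Y: prob_space ?PY by (rule prob_space_distr) simp
  interpret XY: pair_prob_space ?PX ?PY ..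
  \<comment> \<open>Finiteness makes the product sigma algebra discrete, so single pairs are
    measurable.\<close>
  have pair: "count_space UNIV \<Otimes>\<^sub>M count_space UNIV = count_space (UNIV :: ('c \<times> 'd) set)"
    by (subst pair_measure_count_space) simp_all
  have events: "A \<in> sets (count_space UNIV \<Otimes>\<^sub>M count_space UNIV)" for A :: "('c \<times> 'd) set"
    unfolding pair by simp
  have sets: "sets (?PX \<Otimes>\<^sub>M ?PY) = UNIV"
  proof -
    have "sets (?PX \<Otimes>\<^sub>M ?PY) = sets (count_space UNIV \<Otimes>\<^sub>M count_space UNIV)"
      by (intro sets_pair_measure_cong sets_distr)
    then show ?thesis unfolding pair by simp
  qed
  have mX: "measure ?PX {x} = prob {\<omega> \<in> space M. X \<omega> = x}" for x
    by (subst measure_distr) (auto intro!: arg_cong[of _ _ prob])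
  have mY: "measure ?PY {y} = prob {\<omega> \<in> space M. Y \<omega> = y}" for y
    by (subst measure_distr) (auto intro!: arg_cong[of _ _ prob])
  have mXY: "measure ?PXY {(x, y)} = prob {\<omega> \<in> space M. X \<omega> = x \<and> Y \<omega> = y}" for x y
    by (subst measure_distr) (auto simp: events intro!: arg_cong[of _ _ prob])
  have prod: "measure (?PX \<Otimes>\<^sub>M ?PY) {(x, y)} =
      prob {\<omega> \<in> space M. X \<omega> = x} * prob {\<omega> \<in> space M. Y \<omega> = y}" for x y
    unfolding mX[symmetric] mY[symmetric] using Y.emeasure_pair_measure_Times[of "{x}" ?PX "{y}"]
    by (simp add: measure_def enn2real_mult)
  have "mutual_information b (count_space UNIV) (count_space UNIV) X Y = KL_divergence b (?PX \<Otimes>\<^sub>M ?PY) ?PXY"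
    by (simp add: mutual_information_def)
  also have "\<dots> = (\<Sum>z\<in>UNIV. measure ?PXY {z} * log b (measure ?PXY {z} / measure (?PX \<Otimes>\<^sub>M ?PY) {z}))"
  proof (rule KL_divergence_finite)
    show "finite_measure ?PXY"
      by (intro finite_measure_distr) simp
    fix z :: "'c \<times> 'd"
    obtain x y where z: "z = (x, y)" by force
    \<comment> \<open>Absolute continuity: a joint probability is at most either marginal, so it
      vanishes when their product does.\<close>
    have "prob {\<omega> \<in> space M. X \<omega> = x \<and> Y \<omega> = y} \<le> prob {\<omega> \<in> space M. X \<omega> = x}"
      "prob {\<omega> \<in> space M. X \<omega> = x \<and> Y \<omega> = y} \<le> prob {\<omega> \<in> space M. Y \<omega> = y}"
      by (intro finite_measure_mono; auto)+
    then show "measure (?PX \<Otimes>\<^sub>M ?PY) {z} = 0 \<Longrightarrow> measure ?PXY {z} = 0"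
      unfolding z prod mXY mult_eq_0_iff by (auto intro: antisym simp: measure_nonneg)
  qed (use b sets XY.finite_measure_axioms events in auto)
  also have "\<dots> = (\<Sum>(x, y)\<in>UNIV \<times> UNIV. prob {\<omega> \<in> space M. X \<omega> = x \<and> Y \<omega> = y} *
      log b (prob {\<omega> \<in> space M. X \<omega> = x \<and> Y \<omega> = y} /
        (prob {\<omega> \<in> space M. X \<omega> = x} * prob {\<omega> \<in> space M. Y \<omega> = y})))"
    by (intro sum.cong) (auto simp: prod mXY)
  finally show ?thesis
    by (simp only: sum.cartesian_product)
qed

lemma (in prob_space) prob_eq_sum_finite:
  fixes X :: "'a \<Rightarrow> 'c::finite"
  assumes X: "X \<in> measurable M (count_space UNIV)"
  shows "prob {\<omega> \<in> space M. X \<omega> \<in> T} = (\<Sum>x\<in>T. prob {\<omega> \<in> space M. X \<omega> = x})"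
proof -
  note [measurable] = X
  have "{\<omega> \<in> space M. X \<omega> \<in> T} = (\<Union>x\<in>T. {\<omega> \<in> space M. X \<omega> = x})" by auto
  then show ?thesis
    by (auto simp: disjoint_family_on_def intro!: finite_measure_finite_Union)
qed

section \<open>Cosets of a subcode\<close>

lemma Union_cosets:
  assumes "vec.subspace C" "vec.subspace D" "D \<subseteq> C"
  shows "\<Union>(cosets C D) = C"
proof (intro equalityI subsetI)
  fix x assume "x \<in> C"
  then show "x \<in> \<Union>(cosets C D)"
    using vec.subspace_0[OF assms(2)] by (auto simp: cosets_def intro!: bexI[of _ x] image_eqI[of _ _ 0])
next
  fix x assume "x \<in> \<Union>(cosets C D)"
  then obtain c d where "c \<in> C" "d \<in> D" "x = c + d" by (auto simp: cosets_def)
  then show "x \<in> C" using vec.subspace_add[OF assms(1)] assms(3) by auto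
qed

text \<open>Translating by the representative \<open>x\<close> carries the fibre through
  \<open>y = x + d\<close> to the fibre through \<open>d\<close> in \<open>D\<close>, which is a
  translate of the kernel.\<close>

lemma card_fibre_coset:
  fixes f :: "'a::ab_group_add \<Rightarrow> 'b::ab_group_add"
  assumes diff: "\<And>x y. f (x - y) = f x - f y"
    and D: "\<And>x y. x \<in> D \<Longrightarrow> y \<in> D \<Longrightarrow> x + y \<in> D" "\<And>x y. x \<in> D \<Longrightarrow> y \<in> D \<Longrightarrow> x - y \<in> D"
    and E: "E \<in> cosets C D" and y: "y \<in> E"
  shows "card {z \<in> E. f z = f y} = card {z \<in> D. f z = 0}"
proof -
  obtain x where x: "E = (+) x ` D" using E by (auto simp: cosets_def)
  then obtain d where d: "d \<in> D" "y = x + d" using y by auto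
  have add: "f (u + v) = f u + f v" for u v
    using diff[of "u + v" v] by (simp add: algebra_simps)
  have "{z \<in> E. f z = f y} = (+) x ` {z \<in> D. f z = f d}"
    by (auto simp: x d add)
  then have "card {z \<in> E. f z = f y} = card {z \<in> D. f z = f d}"
    by (simp add: card_image)
  then show ?thesis using card_fibre_additive[OF diff D d(1)] by simp
qed

lemma coset_disjoint:
  assumes D: "vec.subspace D" and "E \<in> cosets C D" "F \<in> cosets C D" "E \<noteq> F"
  shows "E \<inter> F = {}"
proof (rule ccontr)
  assume "E \<inter> F \<noteq> {}"
  moreover obtain x y where xy: "E = (+) x ` D" "F = (+) y ` D"
    using assms by (auto simp: cosets_def)
  ultimately obtain d e where de: "d \<in> D" "e \<in> D" "x + d = y + e" by auto
  \<comment> \<open>A coset may be based at any of its points, so two cosets with a common point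
    coincide.\<close>
  have eq: "(+) x ` D = (\<lambda>v. v + (x + d)) ` D" if "d \<in> D" for x d
  proof (intro equalityI subsetI)
    fix z assume "z \<in> (+) x ` D"
    then obtain v where v: "v \<in> D" "z = x + v" by auto
    then show "z \<in> (\<lambda>v. v + (x + d)) ` D"
      using vec.subspace_diff[OF D v(1) that] by (intro image_eqI[of _ _ "v - d"]) auto
  next
    fix z assume "z \<in> (\<lambda>v. v + (x + d)) ` D"
    then obtain v where v: "v \<in> D" "z = v + (x + d)" by auto
    then show "z \<in> (+) x ` D"
      using vec.subspace_add[OF D v(1) that] by (intro image_eqI[of _ _ "v + d"]) (auto simp: algebra_simps)
  qed
  show False using eq[OF de(1), of x] eq[OF de(2), of y] xy de(3) assms(4) by simp
qed

section \<open>Leakage bounds for coset coding\<close>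

theorem lemma25:
  fixes q m :: nat
    and C\<^sub>1 C\<^sub>2 :: "('k::{field,finite} ^ 'n::finite) set"
    and M :: "'w measure"
    and S :: "'w \<Rightarrow> 'k ^ 'l::finite"
    and X :: "'w \<Rightarrow> 'k ^ 'n"
    and W :: "'w \<Rightarrow> 'k ^ 'r::finite"
    and \<psi> :: "'k ^ 'l \<Rightarrow> ('k ^ 'n) set"
    and B :: "'k ^ 'n ^ 'r"
    and b \<Delta> :: real
  assumes "primepow q" and "m \<ge> 1" and "CARD('k) = q ^ m"
    and "vec.subspace C\<^sub>1" and "vec.subspace C\<^sub>2" and "C\<^sub>2 \<subset> C\<^sub>1"
    and "int (vec.dim C\<^sub>2) = int (vec.dim C\<^sub>1) - int CARD('l)"
    and "prob_space M"
    and "S \<in> measurable M (count_space UNIV)"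
    and "X \<in> measurable M (count_space UNIV)"
    and "bij_betw \<psi> UNIV (cosets C\<^sub>1 C\<^sub>2)"
    and "AE \<omega> in M. X \<omega> \<in> \<psi> (S \<omega>)"
  defines "W \<equiv> (\<lambda>\<omega>. B *v X \<omega>)"
    and "b \<equiv> real (q ^ m)"
    and "\<Delta> \<equiv> real (vec.dim (dual_code C\<^sub>2 \<inter> row_space B))
           - real (vec.dim (dual_code C\<^sub>1 \<inter> row_space B))"
  shows "(mutual_info b M S W \<le> \<Delta> + cond_rel_entropy_uniform b M X S \<psi> \<and>
          mutual_info b M S W \<ge> \<Delta> - rel_entropy b (dist_of M S) (uniform_dist UNIV)) \<and>
         (dist_of M S = uniform_dist UNIV \<and> dist_of M X = uniform_dist C\<^sub>1 \<longrightarrow>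
          mutual_info b M S W = \<Delta> + cond_rel_entropy_uniform b M X S \<psi> \<and>
          mutual_info b M S W = \<Delta> - rel_entropy b (dist_of M S) (uniform_dist UNIV) \<and>
          mutual_info b M S W = \<Delta>) \<and>
         ((\<forall>s. measure (dist_of M S) {s} > 0) \<and> mutual_info b M S W = 0 \<longrightarrow> \<Delta> = 0)"
proof -
  interpret prob_space M by fact
  note sub\<^sub>1 = \<open>vec.subspace C\<^sub>1\<close> and sub\<^sub>2 = \<open>vec.subspace C\<^sub>2\<close>
  note [measurable] = \<open>S \<in> measurable M (count_space UNIV)\<close> \<open>X \<in> measurable M (count_space UNIV)\<close>
  define p where "p x = prob {\<omega> \<in> space M. X \<omega> = x}" for x
  let ?\<beta> = "(*v) B"
  have W[measurable]: "W \<in> measurable M (count_space UNIV)"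
    unfolding W_def by measurable
  have \<psi>: "\<psi> s \<in> cosets C\<^sub>1 C\<^sub>2" for s
    using \<open>bij_betw \<psi> UNIV (cosets C\<^sub>1 C\<^sub>2)\<close> by (auto simp: bij_betw_def)
  have disj: "\<psi> s \<inter> \<psi> t = {}" if "s \<noteq> t" for s t
    using coset_disjoint[OF sub\<^sub>2 \<psi> \<psi>] that \<open>bij_betw \<psi> UNIV _\<close>
    by (metis UNIV_I bij_betw_def inj_on_eq_iff)
  have Un: "(\<Union>s. \<psi> s) = C\<^sub>1"
    using Union_cosets[OF sub\<^sub>1 sub\<^sub>2] \<open>C\<^sub>2 \<subset> C\<^sub>1\<close> \<open>bij_betw \<psi> UNIV _\<close>
    by (auto simp: bij_betw_def)
  have card_\<psi>: "card (\<psi> s) = card C\<^sub>2" for s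
    using \<psi>[of s] by (auto simp: cosets_def card_image)
  have b: "1 < b"
  proof -
    have "card {0, 1 :: 'k} \<le> CARD('k)" by (intro card_mono) auto
    then have "1 < q ^ m" using \<open>CARD('k) = q ^ m\<close> by simp
    then show ?thesis by (simp add: b_def del: of_nat_power)
  qed

  \<comment> \<open>Almost surely \<open>X\<close> lies in the block of \<open>S\<close>, and blocks
    are disjoint. Hence \<open>S = s\<close> is the event that \<open>X\<close> lies in
    \<open>\<psi> s\<close> up to a null set, and the law of \<open>X\<close> determines the joint
    law of \<open>S\<close> and \<open>W\<close>.\<close>
  have event: "prob {\<omega> \<in> space M. S \<omega> = s \<and> X \<omega> \<in> T} = (\<Sum>x\<in>T \<inter> \<psi> s. p x)" for s T
  proof -
    have "prob {\<omega> \<in> space M. S \<omega> = s \<and> X \<omega> \<in> T} = prob {\<omega> \<in> space M. X \<omega> \<in> T \<inter> \<psi> s}"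
    proof (rule finite_measure_eq_AE)
      show "AE \<omega> in M. (\<omega> \<in> {\<omega> \<in> space M. S \<omega> = s \<and> X \<omega> \<in> T}) =
          (\<omega> \<in> {\<omega> \<in> space M. X \<omega> \<in> T \<inter> \<psi> s})"
        using \<open>AE \<omega> in M. X \<omega> \<in> \<psi> (S \<omega>)\<close> by eventually_elim (use disj in auto)
    qed measurable
    then show ?thesis by (simp only: prob_eq_sum_finite[OF \<open>X \<in> measurable M _\<close>] p_def)
  qed
  have prob_S: "prob {\<omega> \<in> space M. S \<omega> = s} = (\<Sum>x\<in>\<psi> s. p x)" for s
    using event[of s UNIV] by simp

  interpret D: partitioned_distribution p \<psi> ?\<beta> b "card C\<^sub>2"
    "card {x \<in> C\<^sub>2. B *v x = 0}" "card {x \<in> C\<^sub>1. B *v x = 0}"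
  proof
    show "(\<Sum>s\<in>UNIV. \<Sum>x\<in>\<psi> s. p x) = 1"
      using prob_eq_sum_finite[of S UNIV] by (simp add: prob_S prob_space)
    show "card {y \<in> \<psi> s. B *v y = B *v x} = card {x \<in> C\<^sub>2. B *v x = 0}" if "x \<in> \<psi> s" for s x
      by (intro card_fibre_coset[OF _ _ _ \<psi> that] vec.subspace_add[OF sub\<^sub>2]
          vec.subspace_diff[OF sub\<^sub>2] matrix_vector_mult_diff_distrib)
    show "card {y \<in> (\<Union>s. \<psi> s). B *v y = B *v x} = card {x \<in> C\<^sub>1. B *v x = 0}"
      if "x \<in> (\<Union>s. \<psi> s)" for x
      using that unfolding Un
      by (intro card_fibre_additive vec.subspace_add[OF sub\<^sub>1]
          vec.subspace_diff[OF sub\<^sub>1] matrix_vector_mult_diff_distrib)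
  qed (use b disj card_\<psi> in \<open>auto simp: p_def\<close>)

  have pS: "measure (dist_of M S) {s} = D.pS s" for s
    unfolding D.pS_def prob_S[symmetric]
    by (subst measure_distr) (auto intro!: arg_cong[of _ _ prob])
  have pS': "prob {\<omega> \<in> space M. S \<omega> = s} = D.pS s" for s
    by (simp add: D.pS_def prob_S)
  have pSW: "prob {\<omega> \<in> space M. S \<omega> = s \<and> W \<omega> = w} = D.pSW s w" for s w
    using event[of s "{x. B *v x = w}"] by (simp add: D.pSW_def W_def Int_def conj_commute)
  have pW: "prob {\<omega> \<in> space M. W \<omega> = w} = D.pW w" for w
  proof -
    have "{\<omega> \<in> space M. W \<omega> = w} = (\<Union>s. {\<omega> \<in> space M. S \<omega> = s \<and> W \<omega> = w})" by auto
    moreover have "prob \<dots> = (\<Sum>s\<in>UNIV. prob {\<omega> \<in> space M. S \<omega> = s \<and> W \<omega> = w})"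
      by (intro finite_measure_finite_Union) (auto simp: disjoint_family_on_def)
    ultimately show ?thesis by (simp add: D.pW_def pSW)
  qed
  have information: "mutual_info b M S W = D.information"
    by (simp add: mutual_information_finite[OF b] D.information_def pS' pSW pW)

  have rel_S: "rel_entropy b (dist_of M S) (uniform_dist UNIV) =
      (\<Sum>s\<in>UNIV. D.pS s * log b (D.pS s * CARD('k ^ 'l)))"
  proof -
    have "rel_entropy b (dist_of M S) (uniform_dist UNIV) = (\<Sum>s\<in>UNIV. measure (dist_of M S) {s} *
        log b (measure (dist_of M S) {s} / measure (uniform_dist UNIV) {s}))"
      unfolding rel_entropy_def
      by (intro KL_divergence_finite b finite_measure_distr measure_pmf.finite_measure_axioms)
        (auto simp: measure_pmf_single)
    then show ?thesis by (simp add: pS measure_pmf_single)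
  qed

  have rel_block: "D.pS s * rel_entropy b (cond_dist M X S s) (uniform_dist (\<psi> s)) =
      (\<Sum>x\<in>\<psi> s. p x * log b (p x / D.pS s * card C\<^sub>2))" for s
  proof (cases "D.pS s = 0")
    case True
    \<comment> \<open>In a null block every point mass vanishes, so both sides are 0 whatever value
      \<open>cond_dist\<close> takes.\<close>
    then have "p x = 0" if "x \<in> \<psi> s" for x
      using that D.p_nonneg by (simp add: D.pS_def sum_nonneg_eq_0_iff)
    then show ?thesis using True by simp
  next
    case False
    let ?A = "S -` {s} \<inter> space M"
    have A: "?A \<in> sets M" by measurable
    have prob_A: "prob ?A = D.pS s"
      unfolding pS'[symmetric] by (auto intro!: arg_cong[of _ _ prob])
    then have emeasure_A: "emeasure M ?A \<noteq> 0" "emeasure M ?A \<noteq> \<infinity>"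
      using False D.nonneg(1)[of s] by (auto simp: emeasure_eq_measure ennreal_eq_0_iff)
    interpret A: prob_space "uniform_measure M ?A"
      by (rule prob_space_uniform_measure[OF emeasure_A])
    have cond: "measure (cond_dist M X S s) {x} = (if x \<in> \<psi> s then p x / D.pS s else 0)" for x
    proof -
      have "measure (cond_dist M X S s) {x} = measure (uniform_measure M ?A) (X -` {x} \<inter> space M)"
        unfolding cond_dist_def by (subst measure_distr) auto
      also have "\<dots> = prob (?A \<inter> (X -` {x} \<inter> space M)) / prob ?A"
        using A emeasure_A by (subst measure_uniform_measure) auto
      also have "?A \<inter> (X -` {x} \<inter> space M) = {\<omega> \<in> space M. S \<omega> = s \<and> X \<omega> \<in> {x}}" by auto
      finally show ?thesis unfolding event prob_A by simp
    qed
    have \<psi>_s: "\<psi> s \<noteq> {}" using D.pos_constants(1) card_\<psi>[of s] by auto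
    have unif: "measure (uniform_dist (\<psi> s)) {x} = indicator (\<psi> s) x / card C\<^sub>2" for x
      using \<psi>_s by (simp add: measure_pmf_single card_\<psi>)
    have "rel_entropy b (cond_dist M X S s) (uniform_dist (\<psi> s)) =
        (\<Sum>x\<in>UNIV. measure (cond_dist M X S s) {x} *
          log b (measure (cond_dist M X S s) {x} / measure (uniform_dist (\<psi> s)) {x}))"
      unfolding rel_entropy_def
    proof (intro KL_divergence_finite b measure_pmf.finite_measure_axioms)
      show "finite_measure (cond_dist M X S s)"
        unfolding cond_dist_def by (intro A.finite_measure_distr) simp
      show "measure (uniform_dist (\<psi> s)) {x} = 0 \<Longrightarrow> measure (cond_dist M X S s) {x} = 0" for x
        using D.pos_constants(1) by (auto simp: unif cond indicator_def)
    qed (auto simp: cond_dist_def)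
    also have "\<dots> = (\<Sum>x\<in>\<psi> s. p x / D.pS s * log b (p x / D.pS s * card C\<^sub>2))"
      unfolding cond unif by (intro sum.mono_neutral_cong_right) auto
    finally show ?thesis using False by (simp add: sum_distrib_left)
  qed
  have rel_X: "cond_rel_entropy_uniform b M X S \<psi> =
      (\<Sum>s\<in>UNIV. \<Sum>x\<in>\<psi> s. p x * log b (p x / D.pS s * card C\<^sub>2))"
    unfolding cond_rel_entropy_uniform_def pS rel_block ..

  have image_kernel: "card C = card (?\<beta> ` C) * card {x \<in> C. B *v x = 0}" if "vec.subspace C" for C
    by (intro card_eq_image_kernel vec.subspace_add[OF that] vec.subspace_diff[OF that]
        matrix_vector_mult_diff_distrib finite)
  have "vec.dim C\<^sub>1 = CARD('l) + vec.dim C\<^sub>2"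
    using \<open>int (vec.dim C\<^sub>2) = _\<close> by linarith
  then have card_C: "card C\<^sub>1 = CARD('k ^ 'l) * card C\<^sub>2"
    by (simp add: card_vec_subspace sub\<^sub>1 sub\<^sub>2 power_add)
  have "b powr \<Delta> = card (?\<beta> ` C\<^sub>1) / card (?\<beta> ` C\<^sub>2)"
    unfolding b_def \<Delta>_def using card_dual_code_row_space_ratio[OF sub\<^sub>1 sub\<^sub>2, of B]
    by (simp add: \<open>CARD('k) = q ^ m\<close>)
  also have "\<dots> = D.ratio"
  proof -
    have nz: "real (card (?\<beta> ` C\<^sub>2)) \<noteq> 0" "real (card {x \<in> C\<^sub>1. B *v x = 0}) \<noteq> 0"
      using vec.subspace_0[OF sub\<^sub>1] vec.subspace_0[OF sub\<^sub>2] by auto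
    \<comment> \<open>Both sides are the size of the large code: image times kernel on the left, the
      number of cosets times the size of the small code on the right.\<close>
    have "card (?\<beta> ` C\<^sub>1) * card {x \<in> C\<^sub>1. B *v x = 0} =
        CARD('k ^ 'l) * (card (?\<beta> ` C\<^sub>2) * card {x \<in> C\<^sub>2. B *v x = 0})"
      unfolding image_kernel[OF sub\<^sub>1, symmetric] image_kernel[OF sub\<^sub>2, symmetric] by (rule card_C)
    then have "real (card (?\<beta> ` C\<^sub>1)) * card {x \<in> C\<^sub>1. B *v x = 0} =
        real CARD('k ^ 'l) * (card (?\<beta> ` C\<^sub>2) * card {x \<in> C\<^sub>2. B *v x = 0})"
      unfolding of_nat_mult[symmetric] by (rule arg_cong)
    then show ?thesis
      unfolding D.ratio_def by (simp only: frac_eq_eq[OF nz] of_nat_mult mult_ac)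
  qed
  finally have ratio: "b powr \<Delta> = D.ratio" .
  then have \<Delta>: "\<Delta> = log b D.ratio"
    using b by (simp flip: ratio)

  have upper: "mutual_info b M S W \<le> \<Delta> + cond_rel_entropy_uniform b M X S \<psi>"
    using D.information_le by (simp add: information rel_X \<Delta>)
  have lower: "mutual_info b M S W \<ge> \<Delta> - rel_entropy b (dist_of M S) (uniform_dist UNIV)"
    using D.information_ge by (simp add: information rel_S \<Delta>)
  have "rel_entropy b (dist_of M S) (uniform_dist UNIV) = 0 \<and> cond_rel_entropy_uniform b M X S \<psi> = 0"
    if S: "dist_of M S = uniform_dist UNIV" and X: "dist_of M X = uniform_dist C\<^sub>1"
  proof
    show "rel_entropy b (dist_of M S) (uniform_dist UNIV) = 0"
      unfolding S rel_entropy_def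
      by (intro sigma_finite_measure.KL_same_eq_0 prob_space_imp_sigma_finite prob_space_measure_pmf)
    have "p x * log b (p x / D.pS s * card C\<^sub>2) = 0" if x: "x \<in> \<psi> s" for s x
    proof -
      have "x \<in> C\<^sub>1" using x Un by auto
      have "p x = measure (dist_of M X) {x}"
        unfolding p_def by (subst measure_distr) (auto intro!: arg_cong[of _ _ prob])
      also have "\<dots> = 1 / card C\<^sub>1"
        unfolding X using \<open>x \<in> C\<^sub>1\<close> by (subst measure_pmf_single, subst pmf_of_set) auto
      finally have "p x = 1 / card C\<^sub>1" .
      moreover have "D.pS s = 1 / CARD('k ^ 'l)"
        unfolding pS[symmetric] S by (simp add: measure_pmf_single)
      \<comment> \<open>Uniform \<open>S\<close> and \<open>X\<close> make the conditional law on
        each coset uniform, so the logarithm is taken at 1.\<close>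
      ultimately have "p x / D.pS s * card C\<^sub>2 = 1"
        unfolding card_C using vec.subspace_0[OF sub\<^sub>2] by auto
      then show ?thesis by (simp only: log_one mult_zero_right)
    qed
    then show "cond_rel_entropy_uniform b M X S \<psi> = 0"
      unfolding rel_X by (intro sum.neutral ballI)
  qed
  moreover have "\<Delta> = 0" if "\<forall>s. measure (dist_of M S) {s} > 0" "mutual_info b M S W = 0"
    using D.ratio_eq_1 that by (simp add: pS information \<Delta>)
  ultimately show ?thesis
    using upper lower by auto
qed

end
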